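(* Let $\boldsymbol{u}_0,\dots,\boldsymbol{u}_m\in\mathbb{C}^n$ be the training snapshots with time step $\tau>0$, let $\boldsymbol{A}^{\mathrm{CN}}\in\mathbb{C}^{n\times n}$ be the Hermitian matrix learned from them by the Crank--Nicolson DMD (CN-DMD), let $\{\boldsymbol{x}_k\}_{k\ge0}$ be the CN-DMD iterates with $\boldsymbol{x}_0=\boldsymbol{u}_0$, and let $\boldsymbol{e}_k=\boldsymbol{u}_k-\boldsymbol{x}_k$. Then for any $0\le k\le m-1$, $$\|\boldsymbol{e}_{k+1}\|_2\le\tau\sum_{i=0}^{k}\bigl\|\boldsymbol{l}_i(\boldsymbol{A}^{\mathrm{CN}})\bigr\|_2,$$ where $\boldsymbol{l}_i(\boldsymbol{A}):=\imath\dfrac{\boldsymbol{u}_{i+1}-\boldsymbol{u}_i}{\tau}-\boldsymbol{A}\,\dfrac{\boldsymbol{u}_{i+1}+\boldsymbol{u}_i}{2}$ are the training residuals.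
   Context: Here $\imath$ is the imaginary unit, $\boldsymbol{I}$ the $n\times n$ identity, $^*$ the conjugate transpose, $\|\cdot\|_2$ the Euclidean norm. The vector $\boldsymbol{u}_k\in\mathbb{C}^n$ ($k\ge0$) denotes the values at $n$ equally spaced spatial grid points, at time $t_k=k\tau$, of the true wave function, i.e. of the solution of the semiclassical Schrödinger equation $\imath\varepsilon\partial_t u=-\frac{\varepsilon^2}{2}u_{xx}+V(x)u$ on $(a,b)$ with periodic boundary conditions ($\varepsilon>0$, $V$ real-valued). CN-DMD: $\boldsymbol{A}^{\mathrm{CN}}$ is the minimal-Frobenius-norm solution of the Hermitian-constrained least-squares problem $$\min_{\boldsymbol{A}=\boldsymbol{A}^*}\ \sum_{k=0}^{m-1}\|\boldsymbol{l}_k(\boldsymbol{A})\|_2^2\qquad(\boldsymbol{A}\in\mathbb{C}^{n\times n},\ m\le n).$$ In particular it is Hermitian. The CN-DMD iterates are $$\boldsymbol{x}_{k+1}=\Bigl(\boldsymbol{I}+\imath\tfrac{\tau}{2}\boldsymbol{A}^{\mathrm{CN}}\Bigr)^{-1}\Bigl(\boldsymbol{I}-\imath\tfrac{\tau}{2}\boldsymbol{A}^{\mathrm{CN}}\Bigr)\boldsymbol{x}_k,\qquad k\ge0.$$ *)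

theory Defs
  imports "HOL-Analysis.Analysis"
begin

(* Spatial derivatives at a and b are one-sided.  The potential V is an arbitrary real function and
   no regularity is demanded beyond what is needed to read the equation pointwise and to give
   meaning to the boundary conditions and to the values at time 0. *)
definition semiclassical_solution ::
    "real \<Rightarrow> (real \<Rightarrow> real) \<Rightarrow> real \<Rightarrow> real \<Rightarrow> (real \<Rightarrow> real \<Rightarrow> complex) \<Rightarrow> bool" where
  "semiclassical_solution \<epsilon> V a b \<psi> \<longleftrightarrow>
     continuous_on ({0..} \<times> {a..b}) (\<lambda>(t, x). \<psi> t x) \<and>
     (\<exists>\<psi>\<^sub>t \<psi>\<^sub>x \<psi>\<^sub>x\<^sub>x :: real \<Rightarrow> real \<Rightarrow> complex. \<forall>t>0.
        (\<forall>x\<in>{a..b}. (\<psi> t has_vector_derivative \<psi>\<^sub>x t x) (at x within {a..b})) \<and>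
        (\<forall>x\<in>{a<..<b}.
           ((\<lambda>s. \<psi> s x) has_vector_derivative \<psi>\<^sub>t t x) (at t) \<and>
           (\<psi>\<^sub>x t has_vector_derivative \<psi>\<^sub>x\<^sub>x t x) (at x) \<and>
           \<i> * of_real \<epsilon> * \<psi>\<^sub>t t x
             = - (of_real (\<epsilon>\<^sup>2 / 2) * \<psi>\<^sub>x\<^sub>x t x) + of_real (V x) * \<psi> t x) \<and>
        \<psi> t a = \<psi> t b \<and> \<psi>\<^sub>x t a = \<psi>\<^sub>x t b)"

(* The enumeration p exists because a finite index type carries no order.  The origin and the
   spacing are free, so that x_0 = a (or x_0 = a + h) with h = (b - a) / n is an instance. *)
definition equispaced_grid :: "real \<Rightarrow> real \<Rightarrow> ('n::finite \<Rightarrow> real) \<Rightarrow> bool" where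
  "equispaced_grid a b g \<longleftrightarrow> range g \<subseteq> {a..b} \<and>
     (\<exists>x\<^sub>0 h p. h > 0 \<and> bij_betw p UNIV {..<CARD('n)} \<and> (\<forall>j. g j = x\<^sub>0 + real (p j) * h))"

definition snapshot ::
    "(real \<Rightarrow> real \<Rightarrow> complex) \<Rightarrow> ('n::finite \<Rightarrow> real) \<Rightarrow> real \<Rightarrow> nat \<Rightarrow> complex^'n" where
  "snapshot \<psi> g \<tau> k = (\<chi> j. \<psi> (real k * \<tau>) (g j))"

definition conj_transpose :: "complex^'n^'m \<Rightarrow> complex^'m^'n" where
  "conj_transpose A = map_matrix cnj (transpose A)"

definition hermitian :: "complex^'n^'n \<Rightarrow> bool" where
  "hermitian A \<longleftrightarrow> A = conj_transpose A"

definition frobenius_norm :: "complex^'n^'m \<Rightarrow> real" where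
  "frobenius_norm A = sqrt (\<Sum>i\<in>UNIV. \<Sum>j\<in>UNIV. (cmod (A $ i $ j))\<^sup>2)"

lemma frobenius_norm_eq_norm: "frobenius_norm A = norm A"
  by (simp add: frobenius_norm_def norm_vec_def L2_set_def sum_nonneg)

definition residual ::
    "real \<Rightarrow> (nat \<Rightarrow> complex^'n) \<Rightarrow> nat \<Rightarrow> complex^'n^'n \<Rightarrow> complex^'n" where
  "residual \<tau> u k A =
     (\<i> / of_real \<tau>) *s (u (Suc k) - u k) - A *v ((1 / 2) *s (u (Suc k) + u k))"

definition cn_loss :: "real \<Rightarrow> nat \<Rightarrow> (nat \<Rightarrow> complex^'n) \<Rightarrow> complex^'n^'n \<Rightarrow> real" where
  "cn_loss \<tau> m u A = (\<Sum>k<m. (norm (residual \<tau> u k A))\<^sup>2)"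

definition cn_minimizer :: "real \<Rightarrow> nat \<Rightarrow> (nat \<Rightarrow> complex^'n) \<Rightarrow> complex^'n^'n \<Rightarrow> bool" where
  "cn_minimizer \<tau> m u A \<longleftrightarrow>
     hermitian A \<and> (\<forall>B. hermitian B \<longrightarrow> cn_loss \<tau> m u A \<le> cn_loss \<tau> m u B)"

definition cn_dmd_matrix :: "real \<Rightarrow> nat \<Rightarrow> (nat \<Rightarrow> complex^'n) \<Rightarrow> complex^'n^'n \<Rightarrow> bool" where
  "cn_dmd_matrix \<tau> m u A \<longleftrightarrow>
     cn_minimizer \<tau> m u A \<and>
     (\<forall>B. cn_minimizer \<tau> m u B \<longrightarrow> frobenius_norm A \<le> frobenius_norm B)"

(* mat c is the matrix c I, so mat c ** A is the complex scalar multiple c A. *)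
definition cn_propagator :: "real \<Rightarrow> complex^'n^'n \<Rightarrow> complex^'n^'n" where
  "cn_propagator \<tau> A =
     matrix_inv (mat 1 + mat (\<i> * of_real \<tau> / 2) ** A) ** (mat 1 - mat (\<i> * of_real \<tau> / 2) ** A)"

end

theory Submission
  imports Defs
begin

text \<open>
  The residual is what the snapshots leave over in the Crank--Nicolson scheme, so the errors satisfy
  (e_{k+1} - e_k) + i tau/2 A (e_{k+1} + e_k) = - i tau l_k. Pairing with e_{k+1} + e_k in the
  real inner product annihilates the term with the Hermitian matrix and leaves
  |e_{k+1}|^2 - |e_k|^2 <= tau |l_k| (|e_{k+1}| + |e_k|). Dividing by the sum of the norms bounds
  the growth of the error in one step by tau |l_k|, and these increments add up.
\<close>

lemma hermitian_entry:
  assumes "hermitian A"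
  shows "cnj (A $ i $ j) = A $ j $ i"
proof -
  have "A $ j $ i = conj_transpose A $ j $ i"
    using assms by (simp only: hermitian_def)
  then show ?thesis
    by (simp add: conj_transpose_def map_matrix_def transpose_def)
qed

text \<open>The inner product of the library is the real one, that is, the real part of the
  Hermitian one; so it vanishes on purely imaginary values.\<close>

lemma inner_vec_complex: "(v :: complex^'n) \<bullet> w = Re (\<Sum>i\<in>UNIV. v $ i * cnj (w $ i))"
  by (simp add: inner_vec_def inner_complex_def)

text \<open>The quadratic form of a Hermitian matrix is real, so a purely imaginary factor leaves no
  real part.\<close>

lemma hermitian_imp_skew:
  fixes A :: "complex^'n^'n"
  assumes "hermitian A"
  shows "((\<i> * of_real r) *s (A *v v)) \<bullet> v = 0"
proof -
  define S where "S = (\<Sum>i\<in>UNIV. \<Sum>j\<in>UNIV. A $ i $ j * v $ j * cnj (v $ i))"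
  \<comment> \<open>By Hermitian symmetry, conjugating \<open>S\<close> only exchanges the roles of
    \<open>i\<close> and \<open>j\<close>; swapping the sums restores \<open>S\<close>.\<close>
  have "cnj S = (\<Sum>i\<in>UNIV. \<Sum>j\<in>UNIV. A $ j $ i * v $ i * cnj (v $ j))"
    by (simp add: S_def hermitian_entry[OF assms] mult_ac)
  also have "\<dots> = S"
    unfolding S_def by (rule sum.swap)
  finally have "Im S = 0"
    by (simp add: complex_eq_iff)
  moreover have "(\<Sum>i\<in>UNIV. ((\<i> * of_real r) *s (A *v v)) $ i * cnj (v $ i)) = \<i> * of_real r * S"
    by (simp add: S_def matrix_vector_mult_def sum_distrib_left sum_distrib_right mult.assoc)
  ultimately show ?thesis
    by (simp add: inner_vec_complex)
qed

lemma mat_mult_vector: "(mat c ** A) *v v = c *s ((A :: complex^'n^'m) *v v)"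
proof -
  have "mat c *v w = c *s w" for w :: "complex^'m"
    by (simp add: vec_eq_iff matrix_vector_mult_def mat_def if_distrib[of "\<lambda>x. x * _"] cong: if_cong)
  then show ?thesis
    by (simp add: matrix_vector_mul_assoc[symmetric])
qed

text \<open>The kernel is trivial: pairing the kernel equation with \<open>v\<close> removes the
  skew term and leaves \<open>v \<bullet> v = 0\<close>.\<close>

lemma invertible_cn_denominator:
  fixes A :: "complex^'n^'n"
  assumes "hermitian A"
  shows "invertible (mat 1 + mat (\<i> * of_real \<tau> / 2) ** A)"
proof -
  have "v = 0" if "(mat 1 + mat (\<i> * of_real \<tau> / 2) ** A) *v v = 0" for v
  proof -
    have "(v + (\<i> * of_real (\<tau> / 2)) *s (A *v v)) \<bullet> v = 0"
      using that by (simp add: matrix_vector_mult_add_rdistrib mat_mult_vector)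
    then show ?thesis
      by (simp only: inner_add_left hermitian_imp_skew[OF assms]) simp
  qed
  then show ?thesis
    by (simp add: invertible_left_inverse matrix_left_invertible_ker)
qed

text \<open>Clearing the inverse gives the implicit form of the scheme, in the shape of
  \<open>residual_step\<close> with right-hand side 0.\<close>

lemma cn_propagator_step:
  fixes A :: "complex^'n^'n"
  assumes "hermitian A" and "y = cn_propagator \<tau> A *v x"
  shows "y - x + (\<i> * of_real (\<tau> / 2)) *s (A *v (y + x)) = 0"
proof -
  let ?P = "mat 1 + mat (\<i> * of_real \<tau> / 2) ** A"
  let ?M = "mat 1 - mat (\<i> * of_real \<tau> / 2) ** A"
  have "?P ** matrix_inv ?P = mat 1"
    using invertible_cn_denominator[OF assms(1)]
    unfolding invertible_def matrix_inv_def by (rule someI2_ex) blast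
  then have "?P ** cn_propagator \<tau> A = ?M"
    by (simp add: cn_propagator_def matrix_mul_assoc)
  then have "?P *v y = ?M *v x"
    by (simp add: assms(2) matrix_vector_mul_assoc)
  then show ?thesis
    by (simp add: mat_mult_vector algebra_simps)
qed

text \<open>Multiplying the residual by \<open>- \<i> * of_real \<tau>\<close> turns its factor
  \<open>\<i> / of_real \<tau>\<close> into 1.\<close>

lemma residual_step:
  fixes A :: "complex^'n^'n"
  assumes "\<tau> \<noteq> 0"
  shows "u (Suc k) - u k + (\<i> * of_real (\<tau> / 2)) *s (A *v (u (Suc k) + u k))
    = (- \<i> * of_real \<tau>) *s residual \<tau> u k A"
  using assms
  by (simp add: residual_def vec_eq_iff vector_scalar_commute[symmetric] field_simps
      del: vector_add_ldistrib)

lemma norm_complex_vector_scale: "norm (c *s (v :: complex^'n)) = cmod c * norm v"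
  by (simp add: norm_vec_def norm_mult L2_set_right_distrib)

lemma cn_error_step:
  fixes A :: "complex^'n^'n"
  assumes "hermitian A" and "w - v + (\<i> * of_real s) *s (A *v (w + v)) = r"
  shows "norm w \<le> norm v + norm r"
\<comment> \<open>The sum of the norms is the later divisor; if it is 0, both norms vanish and the
  bound is trivial.\<close>
proof (cases "norm w + norm v = 0")
  case False
  have "(norm w - norm v) * (norm w + norm v) = (w - v) \<bullet> (w + v)"
    by (simp add: algebra_simps inner_commute power2_norm_eq_inner[symmetric] power2_eq_square)
  also have "\<dots> = r \<bullet> (w + v)"
    by (simp only: assms(2)[symmetric] inner_add_left hermitian_imp_skew[OF assms(1)] add_0_right)
  also have "\<dots> \<le> norm r * norm (w + v)"
    by (rule norm_cauchy_schwarz)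
  also have "\<dots> \<le> norm r * (norm w + norm v)"
    by (intro mult_left_mono norm_triangle_ineq) simp
  finally have "norm w - norm v \<le> norm r"
    using False by (simp add: mult_le_cancel_right) (smt (verit) norm_ge_zero)
  then show ?thesis by simp
qed (smt (verit) norm_ge_zero)

theorem theorem3p3:
  fixes \<epsilon> a b \<tau> :: real
    and V :: "real \<Rightarrow> real"
    and \<psi> :: "real \<Rightarrow> real \<Rightarrow> complex"
    and g :: "'n::finite \<Rightarrow> real"
    and m :: nat
    and u x e :: "nat \<Rightarrow> complex^'n"
    and A :: "complex^'n^'n"
  assumes "\<epsilon> > 0" and "a < b" and "\<tau> > 0" and "m \<le> CARD('n)"
    and "semiclassical_solution \<epsilon> V a b \<psi>"
    and "equispaced_grid a b g"
    and "\<And>k. u k = snapshot \<psi> g \<tau> k"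
    and "cn_dmd_matrix \<tau> m u A"
    and "x 0 = u 0" and "\<And>k. x (Suc k) = cn_propagator \<tau> A *v x k"
    and "\<And>k. e k = u k - x k"
  shows "\<forall>k<m. norm (e (Suc k)) \<le> \<tau> * (\<Sum>i=0..k. norm (residual \<tau> u i A))"
proof -
  have herm: "hermitian A"
    using assms(8) by (simp add: cn_dmd_matrix_def cn_minimizer_def)
  have step: "norm (e (Suc k)) \<le> norm (e k) + \<tau> * norm (residual \<tau> u k A)" for k
  proof -
    let ?c = "\<i> * of_real (\<tau> / 2)"
    \<comment> \<open>The scheme is linear, so its value at the error is the value at the snapshots
      minus that at the iterates, and the latter is 0.\<close>
    have "e (Suc k) - e k + ?c *s (A *v (e (Suc k) + e k))
      = (u (Suc k) - u k + ?c *s (A *v (u (Suc k) + u k)))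
        - (x (Suc k) - x k + ?c *s (A *v (x (Suc k) + x k)))"
      by (simp add: assms(11) vec_eq_iff algebra_simps)
    also have "\<dots> = (- \<i> * of_real \<tau>) *s residual \<tau> u k A"
      using residual_step[of \<tau> u k A] cn_propagator_step[OF herm assms(10), of k] \<open>\<tau> > 0\<close>
      by simp
    finally have "norm (e (Suc k)) \<le> norm (e k) + norm ((- \<i> * of_real \<tau>) *s residual \<tau> u k A)"
      by (rule cn_error_step[OF herm])
    then show ?thesis
      using \<open>\<tau> > 0\<close> by (simp add: norm_complex_vector_scale norm_mult)
  qed
  have "norm (e (Suc k)) \<le> \<tau> * (\<Sum>i=0..k. norm (residual \<tau> u i A))" for k
  proof (induction k)
    case 0
    \<comment> \<open>The iterates start at the first snapshot, so \<open>e 0 = 0\<close> and only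
      the residual of step 0 remains.\<close>
    show ?case
      using step[of 0] by (simp add: assms(9) assms(11))
  next
    case (Suc k)
    then show ?case
      using step[of "Suc k"] by (simp add: distrib_left)
  qed
  then show ?thesis by blast
qed

end
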